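(* Let $m, n$ be two positive integers, let $\varepsilon$ be a positive real number, and let $G$ be a connected non-complete graph of even order with $t(G)\geq 1+\varepsilon$. If $\kappa(G)>\frac{(2m+2n-2)(1+\varepsilon)}{\varepsilon}$, then $G$ is $E(m,n)$-extendable.
   Context: All graphs are finite, simple and connected. The order of $G$ is $|V(G)|$, $\kappa(G)$ denotes the vertex connectivity of $G$, and $c(H)$ denotes the number of connected components of a graph $H$. For a non-complete graph $G$, the toughness is $t(G)=\min \frac{|S|}{c(G-S)}$, the minimum taken over all vertex cut-sets $S\subset V(G)$ (sets $S$ for which $G-S$ is disconnected). A matching is a set of pairwise independent (vertex-disjoint) edges; a $k$-matching is a matching with exactly $k$ edges; a perfect matching is a matching covering all vertices. A connected graph $H$ with a perfect matching and $|V(H)|\geq 2m+2$ is called $m$-extendable if every $m$-matching of $H$ is contained in a perfect matching of $H$. A connected graph $G$ with a perfect matching and at least $2m+2n+2$ vertices is called $E(m,n)$-extendable if, after deleting the edges of any $n$-matching of $G$, the resulting graph is $m$-extendable; in other words, for any two matchings $M$ and $N$ of $G$ with $M\cap N=\emptyset$ (as edge sets), $|M|=m$ and $|N|=n$, there is a perfect matching $F$ of $G$ such that $M\subseteq F$ and $N\cap F=\emptyset$. *)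

theory Defs
  imports Complex_Main "Graph_Theory.Kuratowski"
begin

text \<open>
  A finite simple graph is a digraph in the locale \<^locale>\<open>graph\<close>: finite, loop-free, without
  parallel arcs, and symmetric. An undirected edge is thus represented by two opposite arcs;
  everything below that counts or deletes edges works with the unordered pairs of end vertices.
  The constant \<^const>\<open>Digraph_Component.connected\<close> is always written in qualified form because of
  the topological constant with the same base name. It is false for the graph without vertices.
\<close>

definition edges :: "('a, 'b) pre_digraph \<Rightarrow> 'a set set" where
  "edges G = {{tail G a, head G a} | a. a \<in> arcs G}"

definition del_verts :: "('a, 'b) pre_digraph \<Rightarrow> 'a set \<Rightarrow> ('a, 'b) pre_digraph" where
  "del_verts G S = G \<restriction> (verts G - S)"

definition del_edges :: "('a, 'b) pre_digraph \<Rightarrow> 'a set set \<Rightarrow> ('a, 'b) pre_digraph" where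
  "del_edges G N = G\<lparr>arcs := {a \<in> arcs G. {tail G a, head G a} \<notin> N}\<rparr>"

definition num_components :: "('a, 'b) pre_digraph \<Rightarrow> nat" where
  "num_components H = card {C. pre_digraph.max_subgraph H Digraph_Component.connected C}"

text \<open>
  The inclusion is proper since the graph without vertices does not count as disconnected.
\<close>
definition vertex_cut :: "('a, 'b) pre_digraph \<Rightarrow> 'a set \<Rightarrow> bool" where
  "vertex_cut G S \<longleftrightarrow> S \<subset> verts G \<and> \<not> Digraph_Component.connected (del_verts G S)"

text \<open>
  Only meaningful for non-complete graphs; a complete graph has no vertex cut, so that the
  minimum is taken over the empty set.
\<close>
definition toughness :: "('a, 'b) pre_digraph \<Rightarrow> real" where
  "toughness G =
     Min {real (card S) / real (num_components (del_verts G S)) | S. vertex_cut G S}"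

text \<open>
  The least number of vertices whose removal leaves a disconnected graph or a single vertex.
  The second alternative only matters for complete graphs, where it yields one less than the
  order.
\<close>
definition vertex_connectivity :: "('a, 'b) pre_digraph \<Rightarrow> nat" where
  "vertex_connectivity G =
     Min {card S | S. S \<subseteq> verts G \<and> (vertex_cut G S \<or> card (verts G - S) = 1)}"

definition matching :: "('a, 'b) pre_digraph \<Rightarrow> 'a set set \<Rightarrow> bool" where
  "matching G M \<longleftrightarrow> M \<subseteq> edges G \<and> pairwise disjnt M"

definition perfect_matching :: "('a, 'b) pre_digraph \<Rightarrow> 'a set set \<Rightarrow> bool" where
  "perfect_matching G F \<longleftrightarrow> matching G F \<and> \<Union>F = verts G"

definition extendable :: "nat \<Rightarrow> ('a, 'b) pre_digraph \<Rightarrow> bool" where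
  "extendable m H \<longleftrightarrow>
     Digraph_Component.connected H \<and>
     (\<exists>F. perfect_matching H F) \<and>
     2 * m + 2 \<le> card (verts H) \<and>
     (\<forall>M. matching H M \<and> card M = m \<longrightarrow> (\<exists>F. perfect_matching H F \<and> M \<subseteq> F))"

definition E_extendable :: "nat \<Rightarrow> nat \<Rightarrow> ('a, 'b) pre_digraph \<Rightarrow> bool" where
  "E_extendable m n G \<longleftrightarrow>
     Digraph_Component.connected G \<and>
     (\<exists>F. perfect_matching G F) \<and>
     2 * m + 2 * n + 2 \<le> card (verts G) \<and>
     (\<forall>N. matching G N \<and> card N = n \<longrightarrow> extendable m (del_edges G N))"

lemma edges_del_edges: "edges (del_edges G N) = edges G - N"
  by (auto simp: edges_def del_edges_def)

lemma verts_del_edges: "verts (del_edges G N) = verts G"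
  by (simp add: del_edges_def)

text \<open>The usual rephrasing in terms of two disjoint matchings.\<close>
lemma E_extendableD:
  assumes "E_extendable m n G"
    and "matching G M" "matching G N" "M \<inter> N = {}" "card M = m" "card N = n"
  shows "\<exists>F. perfect_matching G F \<and> M \<subseteq> F \<and> N \<inter> F = {}"
proof -
  have "matching (del_edges G N) M"
    using assms(2,4) by (auto simp: matching_def edges_del_edges)
  then obtain F where "perfect_matching (del_edges G N) F" "M \<subseteq> F"
    using assms unfolding E_extendable_def extendable_def by blast
  then have "perfect_matching G F \<and> M \<subseteq> F \<and> N \<inter> F = {}"
    by (auto simp: perfect_matching_def matching_def edges_del_edges verts_del_edges)
  then show ?thesis ..
qed

end

theory Submission
  imports Defs
begin

text \<open>
  A minimum cut leaves at least two components, so \<open>2 (1 + \<epsilon>) \<le> \<kappa>\<close>; substituting this into the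
  lower bound on \<open>\<kappa>\<close> gives \<open>\<kappa> > 2 m + 2 n\<close>. If \<open>M\<close> does not extend to a perfect matching
  avoiding \<open>N\<close>, the Tutte--Berge theorem for \<open>G - N - \<Union>M\<close> yields a set \<open>U\<close> whose removal leaves at
  least \<open>|U| + 2\<close> components. Put \<open>S = \<Union>M \<union> U\<close>. If \<open>|S| \<le> 2 m + n\<close>, then removing \<open>S\<close> and one
  suitably chosen end of each edge of \<open>N\<close> does not disconnect \<open>G\<close>, so \<open>G - N - S\<close> is connected, a
  contradiction. Otherwise restoring the edges of \<open>N\<close> merges at most \<open>n\<close> pairs of components, so
  \<open>S\<close> is a cut with \<open>c(G - S) \<ge> |S| - (2 m + n - 2)\<close>, and toughness forces
  \<open>|S| \<le> (2 m + n - 2) (1 + \<epsilon>) / \<epsilon> < \<kappa>\<close>.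

  Of the Tutte--Berge theorem only the number of components matters, not their parity. Components
  are counted through sets \<open>X\<close> of pairwise unreachable vertices.
\<close>

section \<open>Walks, separated sets and matchings over a set of edges\<close>

text \<open>The edge set and the vertex set vary independently, so that deleting vertices and
  deleting or restoring edges are mere changes of \<open>W\<close> or \<open>E\<close>.\<close>

definition joined :: "'a set set \<Rightarrow> 'a set \<Rightarrow> ('a \<times> 'a) set" where
  "joined E W = {(x, y). x \<in> W \<and> y \<in> W \<and> {x, y} \<in> E}"

definition separated :: "'a set set \<Rightarrow> 'a set \<Rightarrow> 'a set \<Rightarrow> bool" where
  "separated E W X \<longleftrightarrow> X \<subseteq> W \<and> (\<forall>x\<in>X. \<forall>y\<in>X. (x, y) \<in> (joined E W)\<^sup>* \<longrightarrow> x = y)"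

definition matching_in :: "'a set set \<Rightarrow> 'a set \<Rightarrow> 'a set set \<Rightarrow> bool" where
  "matching_in E V M \<longleftrightarrow> M \<subseteq> E \<and> \<Union>M \<subseteq> V \<and> pairwise disjnt M"

lemma sym_joined: "sym (joined E W)"
  by (auto simp: sym_def joined_def insert_commute)

lemma joined_rtrancl_sym: "(x, y) \<in> (joined E W)\<^sup>* \<Longrightarrow> (y, x) \<in> (joined E W)\<^sup>*"
  by (meson sym_joined sym_rtrancl symE)

lemma joined_mono: "E \<subseteq> F \<Longrightarrow> W \<subseteq> W' \<Longrightarrow> joined E W \<subseteq> joined F W'"
  by (auto simp: joined_def)

lemma pairwise_disjnt_same:
  "pairwise disjnt M \<Longrightarrow> e \<in> M \<Longrightarrow> f \<in> M \<Longrightarrow> x \<in> e \<Longrightarrow> x \<in> f \<Longrightarrow> e = f"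
  by (auto simp: pairwise_def disjnt_iff)

lemma card_Union_pairs:
  assumes "pairwise disjnt M" and "\<And>e. e \<in> M \<Longrightarrow> card e = 2"
  shows "card (\<Union>M) = 2 * card M"
proof -
  have "card (\<Union>M) = sum card M"
    using assms by (intro card_Union_disjoint) (auto intro: card_ge_0_finite)
  then show ?thesis
    using assms(2) by simp
qed

text \<open>A new edge can merge only the classes of \<open>a\<close> and \<open>b\<close>, so
  discarding the one vertex of \<open>X\<close>, if any, in the class of \<open>a\<close> restores
  separation.\<close>

lemma separated_insert_edge:
  assumes "separated E W X" and "finite X"
  shows "\<exists>Y\<subseteq>X. separated (insert {a, b} E) W Y \<and> card X \<le> card Y + 1"
proof -
  define Y where "Y = {x \<in> X. (x, a) \<notin> (joined E W)\<^sup>*}"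
  have step: "(joined (insert {a, b} E) W) \<subseteq> joined E W \<union> {(a, b), (b, a)}"
    by (auto simp: joined_def doubleton_eq_iff)
  \<comment> \<open>The alternatives are not symmetric in \<open>a\<close> and \<open>b\<close>:
    each one that uses the new edge links \<open>x\<close> or \<open>z\<close> to \<open>a\<close>
    by old edges, which membership in \<open>Y\<close> excludes.\<close>
  have cases: "(x, z) \<in> (joined E W)\<^sup>* \<or>
      (x, a) \<in> (joined E W)\<^sup>* \<or> (x, b) \<in> (joined E W)\<^sup>* \<and> (a, z) \<in> (joined E W)\<^sup>*"
    if "(x, z) \<in> (joined (insert {a, b} E) W)\<^sup>*" for x z
    using that
  proof (induction rule: rtrancl_induct)
    case (step y z)
    then consider "(y, z) \<in> joined E W" | "y = a" "z = b" | "y = b" "z = a"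
      using \<open>joined (insert {a, b} E) W \<subseteq> _\<close> by auto
    then show ?case
      using step.IH by cases (auto intro: rtrancl_into_rtrancl)
  qed auto
  have "Y \<subseteq> X" by (auto simp: Y_def)
  moreover have "separated (insert {a, b} E) W Y"
    unfolding separated_def
  proof (intro conjI ballI impI)
    show "Y \<subseteq> W"
      using assms by (auto simp: Y_def separated_def)
  next
    fix x y
    assume xy: "x \<in> Y" "y \<in> Y" "(x, y) \<in> (joined (insert {a, b} E) W)\<^sup>*"
    have "(y, a) \<notin> (joined E W)\<^sup>*" and "(x, a) \<notin> (joined E W)\<^sup>*"
      using xy by (auto simp: Y_def)
    then have "(x, y) \<in> (joined E W)\<^sup>*"
      using cases[OF xy(3)] by (auto dest: joined_rtrancl_sym)
    then show "x = y"
      using assms xy by (auto simp: separated_def Y_def)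
  qed
  moreover have "card X \<le> card Y + 1"
  proof -
    have "x = y" if "x \<in> X - Y" "y \<in> X - Y" for x y
    proof -
      have "(x, a) \<in> (joined E W)\<^sup>*" "(a, y) \<in> (joined E W)\<^sup>*"
        using that by (auto simp: Y_def intro: joined_rtrancl_sym)
      then have "(x, y) \<in> (joined E W)\<^sup>*" by (rule rtrancl_trans)
      then show ?thesis
        using that assms(1) by (auto simp: separated_def)
    qed
    then have "card (X - Y) \<le> 1"
      using assms(2) by (simp add: card_le_Suc0_iff_eq)
    then show ?thesis
      using assms(2) \<open>Y \<subseteq> X\<close> by (simp add: card_Diff_subset finite_subset)
  qed
  ultimately show ?thesis by blast
qed

lemma separated_add_edges:
  assumes "finite N" and "\<And>e. e \<in> N \<Longrightarrow> card e = 2" and "separated E W X" and "finite X"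
  shows "\<exists>Y\<subseteq>X. separated (N \<union> E) W Y \<and> card X \<le> card Y + card N"
  using assms(1,2)
proof (induction N rule: finite_induct)
  case empty
  then show ?case using assms by auto
next
  case (insert e N)
  then obtain Y where Y: "Y \<subseteq> X" "separated (N \<union> E) W Y" "card X \<le> card Y + card N"
    by auto
  obtain a b where "e = {a, b}"
    using insert.prems by (meson card_2_iff insertI1)
  then obtain Z where "Z \<subseteq> Y" "separated (insert e (N \<union> E)) W Z" "card Y \<le> card Z + 1"
    using separated_insert_edge[OF Y(2)] Y(1) assms(4) finite_subset by metis
  then show ?case
    using Y insert.hyps by (intro exI[of _ Z]) auto
qed

section \<open>Maximum matchings: Gallai's lemma and the Tutte-Berge bound\<close>

text \<open>
  The transitivity step of Gallai's lemma: if no maximum matching misses both \<open>u\<close> and \<open>t\<close>, and none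
  misses both \<open>v\<close> and \<open>t\<close>, then none misses both \<open>u\<close> and \<open>v\<close>. A maximum matching \<open>N\<close> missing \<open>t\<close> with
  \<open>M \<inter> N\<close> largest could be exchanged for one sharing even more edges with \<open>M\<close>.
\<close>
lemma Gallai_exchange:
  assumes "finite V" and edges: "\<And>e. e \<in> E \<Longrightarrow> card e = 2"
    and M: "matching_in E V M" and M_max: "\<And>M'. matching_in E V M' \<Longrightarrow> card M' \<le> card M"
    and uv: "u \<notin> \<Union>M" "v \<notin> \<Union>M" "u \<noteq> v"
    and t: "\<exists>N. matching_in E V N \<and> card N = card M \<and> t \<notin> \<Union>N"
    and ut: "\<And>N. matching_in E V N \<Longrightarrow> card N = card M \<Longrightarrow> t \<notin> \<Union>N \<Longrightarrow> u \<in> \<Union>N"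
    and vt: "\<And>N. matching_in E V N \<Longrightarrow> card N = card M \<Longrightarrow> t \<notin> \<Union>N \<Longrightarrow> v \<in> \<Union>N"
  shows False
proof -
  have fin: "finite K" "finite (\<Union>K)" "card (\<Union>K) = 2 * card K" if "matching_in E V K" for K
  proof -
    show 1: "finite (\<Union>K)"
      using that assms(1) finite_subset by (auto simp: matching_in_def)
    then show "finite K"
      by (rule finite_UnionD)
    show "card (\<Union>K) = 2 * card K"
      using that edges by (intro card_Union_pairs) (auto simp: matching_in_def)
  qed
  obtain N where N: "matching_in E V N" "card N = card M" "t \<notin> \<Union>N"
    and N_best: "\<And>K. matching_in E V K \<Longrightarrow> card K = card M \<Longrightarrow> t \<notin> \<Union>K \<Longrightarrow>
      card (M \<inter> K) \<le> card (M \<inter> N)"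
  proof -
    obtain N0 where N0: "matching_in E V N0 \<and> card N0 = card M \<and> t \<notin> \<Union>N0"
      using t by blast
    have "card (M \<inter> K) < Suc (card M)" for K
      using fin(1)[OF M] by (simp add: card_mono less_Suc_eq_le)
    then show ?thesis
      using ex_has_greatest_nat[of "\<lambda>K. matching_in E V K \<and> card K = card M \<and> t \<notin> \<Union>K" N0
          "\<lambda>K. card (M \<inter> K)" "Suc (card M)"] N0 that by blast
  qed
  have disj: "pairwise disjnt N" "pairwise disjnt M" "N \<subseteq> E" "M \<subseteq> E" "\<Union>N \<subseteq> V" "\<Union>M \<subseteq> V"
    using N M by (auto simp: matching_in_def)
  \<comment> \<open>\<open>M\<close> and \<open>N\<close> cover equally many vertices, so besides
    \<open>u\<close> and \<open>v\<close>, which only \<open>N\<close> covers, there are at least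
    two that only \<open>M\<close> covers; one of these differs from \<open>t\<close>.\<close>
  have "u \<in> \<Union>N - \<Union>M" "v \<in> \<Union>N - \<Union>M"
    using ut[OF N] vt[OF N] uv by auto
  then have "card {u, v} \<le> card (\<Union>N - \<Union>M)"
    using fin(2)[OF N(1)] by (intro card_mono) auto
  then have "2 \<le> card (\<Union>M - \<Union>N)"
    using uv(3) N(2) fin[OF N(1)] fin[OF M] card_le_sym_Diff[of "\<Union>N" "\<Union>M"] by simp
  then have "\<not> \<Union>M - \<Union>N \<subseteq> {t}"
    using card_mono[of "{t}" "\<Union>M - \<Union>N"] by auto
  then obtain x where x: "x \<in> \<Union>M" "x \<notin> \<Union>N" "x \<noteq> t" by auto
  then obtain e where e: "e \<in> M" "x \<in> e" by auto
  then obtain y where y: "e = {x, y}" "y \<noteq> x"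
    using edges[of e] disj(4) by (auto simp: card_2_iff)
  have "e \<in> E" "e \<subseteq> V" "e \<notin> N"
    using e disj x by auto
  have "y \<in> \<Union>N"
  proof (rule ccontr)
    assume "y \<notin> \<Union>N"
    then have "matching_in E V (insert e N)"
      using x(2) y(1) disj \<open>e \<in> E\<close> \<open>e \<subseteq> V\<close>
      by (auto simp: matching_in_def pairwise_insert disjnt_iff)
    from M_max[OF this] show False
      using \<open>e \<notin> N\<close> fin(1)[OF N(1)] N(2) by simp
  qed
  then obtain f where f: "f \<in> N" "y \<in> f" by auto
  have "f \<notin> M"
    using pairwise_disjnt_same[OF disj(2) e(1), of f y] y(1) f x(2) e by auto
  \<comment> \<open>The exchange newly covers only \<open>x\<close>, so \<open>t\<close> stays
    missed. As \<open>f\<close> meets \<open>e\<close> without equalling it, \<open>f\<close> is not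
    in \<open>M\<close>, and the overlap with \<open>M\<close> grows by one.\<close>
  define K where "K = insert e (N - {f})"
  have sub: "\<Union>K \<subseteq> \<Union>N \<union> e"
    by (auto simp: K_def)
  have "matching_in E V K"
  proof -
    have "disjnt e g" if "g \<in> N - {f}" for g
      using that x(2) y(1) f pairwise_disjnt_same[OF disj(1), of g f y] by (auto simp: disjnt_iff)
    then have "pairwise disjnt K"
      using disj(1) unfolding K_def pairwise_insert
      by (auto simp: disjnt_sym intro: pairwise_subset)
    then show ?thesis
      using disj \<open>e \<in> E\<close> \<open>e \<subseteq> V\<close> by (auto simp: matching_in_def K_def)
  qed
  moreover have "card K = card M"
    using \<open>e \<notin> N\<close> f(1) fin(1)[OF N(1)] N(2) card_Suc_Diff1[of N f] by (simp add: K_def)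
  moreover have "t \<notin> \<Union>K"
    using sub N(3) x(3) y(1) \<open>y \<in> \<Union>N\<close> by auto
  ultimately have "card (M \<inter> K) \<le> card (M \<inter> N)"
    by (rule N_best)
  moreover have "M \<inter> K = insert e (M \<inter> N)"
    using e(1) \<open>f \<notin> M\<close> by (auto simp: K_def)
  ultimately show False
    using \<open>e \<notin> N\<close> fin(1)[OF N(1)] by simp
qed

text \<open>
  Induction on the vertex set: a vertex covered by every maximum matching goes into \<open>U\<close>. If there is
  none, Gallai's lemma shows that the vertices missed by a maximum matching lie in different
  components, so that \<open>U = {}\<close> will do.
\<close>
lemma Tutte_Berge_separated:
  assumes "finite V" and edges: "\<And>e. e \<in> E \<Longrightarrow> card e = 2"
  shows "\<exists>U X M. U \<subseteq> V \<and> separated E (V - U) X \<and> matching_in E V M \<and>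
    card V + card U \<le> card X + 2 * card M"
  using assms(1)
proof (induction V rule: finite_psubset_induct)
  case (psubset V)
  have bound: "card M \<le> card V" if "matching_in E V M" for M
  proof -
    have "card (\<Union>M) = 2 * card M"
      using that edges by (intro card_Union_pairs) (auto simp: matching_in_def)
    moreover have "card (\<Union>M) \<le> card V"
      using that psubset.hyps by (auto simp: matching_in_def intro: card_mono)
    ultimately show ?thesis by simp
  qed
  have "matching_in E V {}" by (simp add: matching_in_def)
  then obtain M where M: "matching_in E V M" and
    M_max: "\<And>K. matching_in E V K \<Longrightarrow> card K \<le> card M"
    using ex_has_greatest_nat[of "matching_in E V" "{}" card "Suc (card V)"] bound
    by (auto simp: less_Suc_eq_le)
  show ?case
  proof (cases "\<exists>v\<in>V. \<forall>K. matching_in E V K \<and> card K = card M \<longrightarrow> v \<in> \<Union>K")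
    case True
    then obtain v where v: "v \<in> V" "\<And>K. matching_in E V K \<Longrightarrow> card K = card M \<Longrightarrow> v \<in> \<Union>K"
      by blast
    obtain U X K where IH: "U \<subseteq> V - {v}" "separated E (V - {v} - U) X" "matching_in E (V - {v}) K"
      "card (V - {v}) + card U \<le> card X + 2 * card K"
      using psubset.IH[of "V - {v}"] v(1) by blast
    have K: "matching_in E V K" "v \<notin> \<Union>K"
      using IH(3) by (auto simp: matching_in_def)
    \<comment> \<open>A matching of size \<open>card M\<close> would cover \<open>v\<close>, which
      \<open>K\<close> misses. The gain of one edge pays for counting \<open>v\<close> both in
      \<open>V\<close> and in \<open>insert v U\<close>.\<close>
    then have "card K < card M"
      using M_max v(2) by (metis le_neq_implies_less)
    moreover have "card (insert v U) = Suc (card U)"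
      using IH(1) psubset.hyps by (metis Diff_iff card_insert_disjoint finite_Diff finite_subset insertI1 subsetD)
    moreover have "card V = Suc (card (V - {v}))"
      using v(1) psubset.hyps by (metis card_Suc_Diff1)
    ultimately have "card V + card (insert v U) \<le> card X + 2 * card M"
      using IH(4) by linarith
    moreover have "separated E (V - insert v U) X"
      using IH(2) by (simp only: Diff_insert2[of V v U])
    moreover have "insert v U \<subseteq> V"
      using IH(1) v(1) by blast
    ultimately show ?thesis
      using M by blast
  next
    case False
    have exch: "v = u \<or> (\<forall>K. matching_in E V K \<and> card K = card M \<longrightarrow> u \<in> \<Union>K \<or> v \<in> \<Union>K)"
      if "(u, v) \<in> (joined E V)\<^sup>*" for u v
      using that
    proof (induction rule: rtrancl_induct)
      case (step t v)
      show ?case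
      proof (intro disjCI allI impI)
        fix K
        assume "\<not> (\<forall>K. matching_in E V K \<and> card K = card M \<longrightarrow> u \<in> \<Union>K \<or> v \<in> \<Union>K)"
        then obtain K where K: "matching_in E V K" "card K = card M" "u \<notin> \<Union>K" "v \<notin> \<Union>K"
          by blast
        have tv: "t \<in> V" "v \<in> V" "{t, v} \<in> E"
          using step.hyps by (auto simp: joined_def)
        have edge: "v \<in> \<Union>N" if N: "matching_in E V N" "card N = card M" "t \<notin> \<Union>N" for N
        proof (rule ccontr)
          assume "v \<notin> \<Union>N"
          then have "matching_in E V (insert {t, v} N)"
            using N tv by (auto simp: matching_in_def pairwise_insert disjnt_iff)
          moreover have "{t, v} \<notin> N" "finite N"
            using N psubset.hyps finite_subset
            by (auto simp: matching_in_def intro: finite_UnionD)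
          ultimately show False
            using M_max[of "insert {t, v} N"] N(2) by simp
        qed
        show "v = u"
        proof (rule ccontr)
          assume "v \<noteq> u"
          \<comment> \<open>If \<open>t = u\<close>, then \<open>K\<close> misses two adjacent
            vertices, against \<open>edge\<close>. Otherwise the induction hypothesis supplies the
            premise on \<open>u\<close> and \<open>t\<close> of the exchange lemma, and
            \<open>edge\<close> the one on \<open>v\<close> and \<open>t\<close>.\<close>
          have "t \<noteq> u"
            using edge K by auto
          then have "u \<in> \<Union>N" if "matching_in E V N" "card N = card M" "t \<notin> \<Union>N" for N
            using step.IH that by blast
          moreover have "\<exists>N. matching_in E V N \<and> card N = card M \<and> t \<notin> \<Union>N"
            using False tv(1) by blast
          ultimately show False
            using Gallai_exchange[OF psubset.hyps edges K(1), of u v t] K \<open>v \<noteq> u\<close> M_max edge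
            by simp
        qed
      qed
    qed simp
    have "separated E V (V - \<Union>M)"
      using exch M by (fastforce simp: separated_def)
    moreover have "card V = card (V - \<Union>M) + 2 * card M"
    proof -
      have "\<Union>M \<subseteq> V" using M by (simp add: matching_in_def)
      moreover have "card (\<Union>M) = 2 * card M"
        using M edges by (intro card_Union_pairs) (auto simp: matching_in_def)
      ultimately show ?thesis
        using psubset.hyps by (metis card_Diff_subset card_mono finite_subset le_add_diff_inverse2)
    qed
    ultimately show ?thesis
      using M by (intro exI[of _ "{}"] exI[of _ "V - \<Union>M"] exI[of _ M]) auto
  qed
qed

section \<open>Reachability and components of symmetric digraphs\<close>

lemma joined_edges:
  assumes "sym_digraph H"
  shows "joined (edges H) (verts H) = arcs_ends H"
proof -
  interpret sym_digraph H by fact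
  show ?thesis
    using arcs_ends_symmetric[OF sym_arcs]
    by (fastforce simp: joined_def edges_def arcs_ends_conv doubleton_eq_iff)
qed

lemma reachable_iff_joined:
  assumes "sym_digraph H" and "u \<in> verts H"
  shows "u \<rightarrow>\<^sup>*\<^bsub>H\<^esub> v \<longleftrightarrow> (u, v) \<in> (joined (edges H) (verts H))\<^sup>*"
  using assms wf_digraph.reachable_conv'[of H] by (simp add: joined_edges sym_digraph_def)

lemma connected_iff_joined:
  assumes "sym_digraph H"
  shows "Digraph_Component.connected H \<longleftrightarrow> verts H \<noteq> {} \<and>
    (\<forall>u\<in>verts H. \<forall>v\<in>verts H. (u, v) \<in> (joined (edges H) (verts H))\<^sup>*)"
proof -
  interpret sym_digraph H by fact
  have "Digraph_Component.connected H \<longleftrightarrow> strongly_connected H"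
    using reachable_mk_symmetric_eq[OF sym_arcs]
    by (simp add: connected_def strongly_connected_def)
  then show ?thesis
    using assms by (simp add: strongly_connected_def reachable_iff_joined)
qed

text \<open>Compatibility fixes \<open>tail\<close> and \<open>head\<close>, so a subgraph is
  determined by its vertices and arcs.\<close>

lemma fin_digraph_finite_subgraphs:
  assumes "fin_digraph H"
  shows "finite {C. subgraph C H}"
proof (rule inj_on_finite)
  interpret fin_digraph H by fact
  show "inj_on (\<lambda>C. (verts C, arcs C)) {C. subgraph C H}"
    by (auto simp: inj_on_def subgraph_def compatible_def intro: pre_digraph.equality)
  show "(\<lambda>C. (verts C, arcs C)) ` {C. subgraph C H} \<subseteq> Pow (verts H) \<times> Pow (arcs H)"
    by (auto simp: subgraph_def)
  show "finite (Pow (verts H) \<times> Pow (arcs H))"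
    by simp
qed

text \<open>Weak and strong connectivity agree on symmetric digraphs, so the reachability class of
  \<open>x\<close> carries the component of \<open>x\<close>.\<close>

lemma max_subgraph_connected_reachable:
  assumes "sym_digraph H" and "x \<in> verts H"
  shows "pre_digraph.max_subgraph H Digraph_Component.connected (H \<restriction> {v. x \<rightarrow>\<^sup>*\<^bsub>H\<^esub> v})"
    (is "pre_digraph.max_subgraph H _ ?C")
proof -
  interpret sym_digraph H by fact
  have "?C \<in> sccs"
    using assms(2) by (rule induce_reachable_is_in_sccs)
  then have C: "induced_subgraph ?C H" "strongly_connected ?C"
    by auto
  interpret C: sym_digraph ?C
    using C(1) by (rule induced_graph_imp_graph)
  have "Digraph_Component.connected ?C"
    using C(2) C.reachable_mk_symmetric_eq[OF C.sym_arcs]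
    by (simp add: connected_def strongly_connected_def)
  moreover have "D = ?C"
    if D: "subgraph ?C D" "subgraph D H" "Digraph_Component.connected D" for D
  proof -
    have x: "x \<in> verts D"
      using D(1) assms(2) by (auto simp: subgraph_def)
    \<comment> \<open>\<open>D\<close> need not be symmetric, so its connectedness only gives walks
      in its symmetric closure; these become walks of \<open>H\<close> because \<open>H\<close> is
      symmetric.\<close>
    have "verts D \<subseteq> {v. x \<rightarrow>\<^sup>*\<^bsub>H\<^esub> v}"
    proof
      fix v assume "v \<in> verts D"
      then have "x \<rightarrow>\<^sup>*\<^bsub>mk_symmetric D\<^esub> v"
        using D(3) x by (auto simp: connected_def strongly_connected_def)
      then have "x \<rightarrow>\<^sup>*\<^bsub>mk_symmetric H\<^esub> v"
        using D(2) by (rule pre_digraph.reachable_mono[OF _ subgraph_mk_symmetric])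
      then show "v \<in> {v. x \<rightarrow>\<^sup>*\<^bsub>H\<^esub> v}"
        using reachable_mk_symmetric_eq[OF sym_arcs] by simp
    qed
    moreover interpret D: wf_digraph D
      using D(2) by (simp add: subgraph_def)
    have "tail D = tail H" "head D = head H" "arcs D \<subseteq> arcs H"
      using D(2) by (auto simp: subgraph_def compatible_def)
    ultimately have "arcs D \<subseteq> arcs ?C" "verts D \<subseteq> verts ?C"
      using D.tail_in_verts D.head_in_verts by auto
    then show ?thesis
      using D(1) \<open>tail D = tail H\<close> \<open>head D = head H\<close>
      by (intro pre_digraph.equality) (auto simp: subgraph_def)
  qed
  ultimately show ?thesis
    using C(1) by (auto simp: max_subgraph_def induced_subgraph_def)
qed

lemma separated_le_num_components:
  assumes "graph H" and X: "separated (edges H) (verts H) X"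
  shows "card X \<le> num_components H"
proof -
  interpret graph H by fact
  have sym: "sym_digraph H" by unfold_locales
  let ?comp = "\<lambda>x. H \<restriction> {v. x \<rightarrow>\<^sup>*\<^bsub>H\<^esub> v}"
  have X_verts: "X \<subseteq> verts H"
    using X by (simp add: separated_def)
  have "inj_on ?comp X"
  proof (rule inj_onI)
    fix x y assume xy: "x \<in> X" "y \<in> X" "?comp x = ?comp y"
    then have "verts (?comp x) = verts (?comp y)" by simp
    then have "x \<rightarrow>\<^sup>*\<^bsub>H\<^esub> y"
      using X_verts xy(2) by auto
    then show "x = y"
      using xy X X_verts reachable_iff_joined[OF sym, of x y] by (auto simp: separated_def)
  qed
  moreover have "?comp ` X \<subseteq> {C. max_subgraph Digraph_Component.connected C}"
    using max_subgraph_connected_reachable[OF sym] X_verts by auto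
  \<comment> \<open>Without finiteness the cardinality in \<open>num_components\<close> would
    default to 0.\<close>
  moreover have "finite {C. max_subgraph Digraph_Component.connected C}"
    using fin_digraph_finite_subgraphs[OF fin_digraph]
    by (rule rev_finite_subset) (auto simp: max_subgraph_def)
  ultimately show ?thesis
    unfolding num_components_def by (rule card_inj_on_le)
qed

lemma verts_del_verts [simp]: "verts (del_verts G S) = verts G - S"
  by (simp add: del_verts_def)

lemma graph_del_verts:
  assumes "graph G"
  shows "graph (del_verts G S)"
proof -
  interpret graph G by fact
  have sub: "induced_subgraph (del_verts G S) G"
    unfolding del_verts_def by (rule induced_induce) auto
  interpret D: digraph "del_verts G S"
    using sub by (rule digraphI_induced)
  show ?thesis
    by (rule D.graphI) (rule induced_graph_imp_symmetric[OF sym_arcs sub])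
qed

lemma sym_digraph_del_edges:
  assumes "graph G"
  shows "sym_digraph (del_edges G N)"
proof -
  interpret graph G by fact
  show ?thesis
  proof
    show "symmetric (del_edges G N)"
      using sym_arcs by (fastforce simp: symmetric_conv del_edges_def insert_commute)
  qed (auto simp: del_edges_def)
qed

lemma joined_del_verts:
  "joined (edges (del_verts G S)) (verts G - S) = joined (edges G) (verts G - S)"
  by (fastforce simp: joined_def edges_def del_verts_def doubleton_eq_iff)

section \<open>Vertex cuts, connectivity and toughness of a fixed graph\<close>

context
  fixes G :: "('a, 'b) pre_digraph"
  assumes graph: "graph G"
begin

interpretation graph G by (rule graph)

lemma card_edge: "e \<in> edges G \<Longrightarrow> card e = 2"
  using no_loops by (auto simp: edges_def card_2_iff)

lemma edge_subset_verts: "e \<in> edges G \<Longrightarrow> e \<subseteq> verts G"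
  by (auto simp: edges_def)

lemma finite_edges: "finite (edges G)"
  by (simp add: edges_def)

lemma vertex_cut_iff:
  "vertex_cut G S \<longleftrightarrow> S \<subset> verts G \<and>
    (\<exists>u\<in>verts G - S. \<exists>v\<in>verts G - S. (u, v) \<notin> (joined (edges G) (verts G - S))\<^sup>*)"
proof -
  interpret D: graph "del_verts G S"
    using graph by (rule graph_del_verts)
  have "sym_digraph (del_verts G S)" by unfold_locales
  from connected_iff_joined[OF this] show ?thesis
    by (auto simp: vertex_cut_def joined_del_verts)
qed

lemma separated_le_num_components_del_verts:
  assumes "separated (edges G) (verts G - S) X"
  shows "card X \<le> num_components (del_verts G S)"
  using assms separated_le_num_components[OF graph_del_verts[OF graph], of S X]
  by (simp add: separated_def joined_del_verts)

lemma finite_cuts: "finite {S. vertex_cut G S}"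
  by (rule finite_subset[of _ "Pow (verts G)"]) (auto simp: vertex_cut_def)

lemma vertex_connectivity_le:
  assumes "vertex_cut G S"
  shows "vertex_connectivity G \<le> card S"
  unfolding vertex_connectivity_def
proof (rule Min_le)
  show "finite {card S | S. S \<subseteq> verts G \<and> (vertex_cut G S \<or> card (verts G - S) = 1)}"
    by (rule finite_subset[of _ "card ` Pow (verts G)"]) auto
qed (use assms in \<open>auto simp: vertex_cut_def\<close>)

text \<open>The ratio only grows when the number of components is replaced by the smaller
  \<open>card X\<close>, which is positive since \<open>X\<close> is nonempty.\<close>

lemma toughness_le:
  assumes "vertex_cut G S" and "separated (edges G) (verts G - S) X" and "X \<noteq> {}"
  shows "toughness G * card X \<le> card S"
proof -
  have fin: "finite X"
    using assms(2) finite_subset by (fastforce simp: separated_def)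
  have "toughness G \<le> real (card S) / real (num_components (del_verts G S))"
    unfolding toughness_def
  proof (rule Min_le)
    show "finite {real (card S) / real (num_components (del_verts G S)) |S. vertex_cut G S}"
      using finite_cuts by (simp add: setcompr_eq_image)
  qed (use assms in auto)
  also have "\<dots> \<le> real (card S) / real (card X)"
  proof -
    have "0 < card X"
      using fin assms(3) by (simp add: card_gt_0_iff)
    then show ?thesis
      using separated_le_num_components_del_verts[OF assms(2)]
      by (intro divide_left_mono mult_pos_pos) auto
  qed
  finally show ?thesis
    using fin assms(3) by (simp add: field_simps card_gt_0_iff)
qed

text \<open>In a non-complete graph, removing all vertices but two non-adjacent ones is a cut. Hence
  the connectivity is at most the order minus 2.\<close>

lemma vertex_connectivity_attained:
  assumes "\<not> complete_digraph (card (verts G)) G"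
  obtains S where "vertex_cut G S" and "vertex_connectivity G = card S"
    and "vertex_connectivity G + 2 \<le> card (verts G)"
proof -
  obtain u v where uv: "u \<in> verts G" "v \<in> verts G" "u \<noteq> v" "(u, v) \<notin> arcs_ends G"
  proof -
    have "arcs_ends G \<subseteq> {(u, v). (u, v) \<in> verts G \<times> verts G \<and> u \<noteq> v}"
      using no_loops by (auto simp: arcs_ends_conv)
    then show ?thesis
      using assms graph that by (auto simp: complete_digraph_def)
  qed
  let ?T = "verts G - {u, v}"
  have T: "verts G - ?T = {u, v}"
    using uv by auto
  have sub: "joined (edges G) {u, v} \<subseteq> Id"
  proof -
    have "sym_digraph G" by unfold_locales
    then have "joined (edges G) {u, v} \<subseteq> arcs_ends G"
      using joined_edges[of G] joined_mono[of "edges G" "edges G" "{u, v}" "verts G"] uv by auto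
    then show ?thesis
      using uv graph_symmetric by (auto simp: joined_def)
  qed
  have "x = y" if "(x, y) \<in> (joined (edges G) {u, v})\<^sup>*" for x y
    using that by induction (use sub in auto)
  then have "(u, v) \<notin> (joined (edges G) (verts G - ?T))\<^sup>*"
    using uv(3) unfolding T by blast
  then have "vertex_cut G ?T"
    unfolding vertex_cut_iff using uv by blast
  moreover have "card ?T + 2 = card (verts G)"
    using uv card_mono[of "verts G" "{u, v}"] by (simp add: card_Diff_subset)
  ultimately have small: "vertex_connectivity G + 2 \<le> card (verts G)"
    using vertex_connectivity_le[of ?T] by simp
  let ?A = "{card S | S. S \<subseteq> verts G \<and> (vertex_cut G S \<or> card (verts G - S) = 1)}"
  have "finite ?A"
    by (rule finite_subset[of _ "card ` Pow (verts G)"]) auto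
  moreover have "?A \<noteq> {}"
    using \<open>vertex_cut G ?T\<close> by blast
  ultimately have "vertex_connectivity G \<in> ?A"
    unfolding vertex_connectivity_def by (rule Min_in)
  then obtain S where S: "vertex_connectivity G = card S" "S \<subseteq> verts G"
    "vertex_cut G S \<or> card (verts G - S) = 1"
    by blast
  \<comment> \<open>The single-vertex alternative would make \<open>card S\<close> the order minus
    1, which exceeds the connectivity.\<close>
  have "card (verts G - S) \<noteq> 1"
    using small S finite_subset[OF S(2)] by (simp add: card_Diff_subset)
  then show ?thesis
    using that S small by blast
qed

end

section \<open>Connectedness after deleting a matching, and the final inequality\<close>

text \<open>If \<open>{u, v}\<close> is not in \<open>N\<close>, every edge of \<open>N\<close> has
  an end other than \<open>u\<close> and \<open>v\<close>. Deleting these ends along with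
  \<open>S\<close> destroys all of \<open>N\<close> at a cost of at most \<open>card N\<close>
  vertices, so \<open>robust\<close> yields a walk avoiding \<open>N\<close>. The bound
  \<open>large\<close> provides a third vertex for the case that \<open>{u, v}\<close> is in
  \<open>N\<close>.\<close>

lemma connected_minus_matching:
  assumes edges: "\<And>e. e \<in> E \<Longrightarrow> card e = 2"
    and robust: "\<And>T u v. T \<subseteq> V \<Longrightarrow> card T \<le> k \<Longrightarrow> u \<in> V - T \<Longrightarrow> v \<in> V - T \<Longrightarrow>
      (u, v) \<in> (joined E (V - T))\<^sup>*"
    and N: "matching_in E V N" "finite N"
    and S: "S \<subseteq> V" "card S + card N \<le> k" "finite S"
    and large: "3 \<le> card (V - S)"
    and uv: "u \<in> V - S" "v \<in> V - S"
  shows "(u, v) \<in> (joined (E - N) (V - S))\<^sup>*"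
proof -
  have nonadj: "(u, v) \<in> (joined (E - N) (V - S))\<^sup>*"
    if uv: "u \<in> V - S" "v \<in> V - S" "{u, v} \<notin> N" for u v
  proof -
    have "\<exists>x. x \<in> e \<and> x \<noteq> u \<and> x \<noteq> v" if "e \<in> N" for e
    proof -
      have "card e = 2"
        using that N edges by (auto simp: matching_in_def)
      then obtain x y where "e = {x, y}" "x \<noteq> y"
        by (auto simp: card_2_iff)
      then show ?thesis
        using that uv(3) by (metis insert_commute insert_iff)
    qed
    then obtain p where p: "\<And>e. e \<in> N \<Longrightarrow> p e \<in> e \<and> p e \<noteq> u \<and> p e \<noteq> v"
      by metis
    define T where "T = S \<union> p ` N"
    have "p e \<in> V" if "e \<in> N" for e
      using p[OF that] that N(1) unfolding matching_in_def by blast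
    then have "T \<subseteq> V"
      using S(1) by (auto simp: T_def)
    moreover have "card T \<le> k"
      using S(2) card_Un_le[of S "p ` N"] card_image_le[OF N(2), of p] by (simp add: T_def)
    moreover have "u \<in> V - T" "v \<in> V - T"
      using uv p by (auto simp: T_def)
    ultimately have "(u, v) \<in> (joined E (V - T))\<^sup>*"
      by (rule robust)
    moreover have "joined E (V - T) \<subseteq> joined (E - N) (V - S)"
    proof -
      have "{x, y} \<notin> N" if "x \<in> V - T" "y \<in> V - T" for x y
      proof
        assume "{x, y} \<in> N"
        then have "p {x, y} \<in> T" "p {x, y} \<in> {x, y}"
          using p[of "{x, y}"] unfolding T_def by blast+
        then show False
          using that by auto
      qed
      then show ?thesis
        by (auto simp: joined_def T_def)
    qed
    ultimately show ?thesis
      using rtrancl_mono by blast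
  qed
  show ?thesis
  proof (cases "{u, v} \<in> N")
    case True
    \<comment> \<open>Detour through a third vertex, which is \<open>N\<close>-adjacent to neither, \<open>N\<close> being a matching.\<close>
    have "\<not> V - S \<subseteq> {u, v}"
      using large card_mono[of "{u, v}" "V - S"] by (auto simp: card_insert_if split: if_splits)
    then obtain w where w: "w \<in> V - S" "w \<noteq> u" "w \<noteq> v" by auto
    have "{u, w} \<notin> N" "{w, v} \<notin> N"
      using True w N(1) pairwise_disjnt_same[of N "{u, v}"] unfolding matching_in_def
      by (metis doubleton_eq_iff insertCI)+
    then show ?thesis
      using nonadj uv w(1) by (meson rtrancl_trans)
  qed (use nonadj uv in blast)
qed

text \<open>Solves the toughness inequality for \<open>x = card S\<close>, with
  \<open>a = 2 * m + n - 2\<close> from the component count and \<open>b = 2 * m + 2 * n - 2\<close>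
  from the connectivity hypothesis.\<close>

lemma ratio_bound:
  fixes a b x \<epsilon> :: real
  assumes "0 < \<epsilon>" and "(x - a) * (1 + \<epsilon>) \<le> x" and "a \<le> b"
  shows "x \<le> b * (1 + \<epsilon>) / \<epsilon>"
proof -
  have "x * \<epsilon> \<le> a * (1 + \<epsilon>)"
    using assms(2) by (simp add: algebra_simps)
  also have "\<dots> \<le> b * (1 + \<epsilon>)"
    using assms(1,3) by (simp add: mult_right_mono)
  finally show ?thesis
    using assms(1) by (simp add: pos_le_divide_eq)
qed

section \<open>Extendability from toughness and connectivity\<close>

theorem corollary3p3:
  fixes G :: "('a, 'b) pre_digraph" and m n :: nat and \<epsilon> :: real
  assumes "0 < m" and "0 < n" and "0 < \<epsilon>"
    and "graph G"
    and "Digraph_Component.connected G"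
    and "\<not> complete_digraph (card (verts G)) G"
    and "even (card (verts G))"
    and "1 + \<epsilon> \<le> toughness G"
    and "(2 * real m + 2 * real n - 2) * (1 + \<epsilon>) / \<epsilon> < real (vertex_connectivity G)"
  shows "E_extendable m n G"
proof -
  interpret graph G by fact
  let ?E = "edges G" and ?V = "verts G" and ?\<kappa> = "vertex_connectivity G"
  note card_edge = card_edge[OF \<open>graph G\<close>]
  have matching_iff: "matching G M \<longleftrightarrow> matching_in ?E ?V M" for M
    using edge_subset_verts[OF \<open>graph G\<close>] by (auto simp: matching_def matching_in_def)
  have fin_matching: "finite M" if "matching G M" for M
    using that finite_edges[OF \<open>graph G\<close>] by (auto simp: matching_def intro: finite_subset)
  have tough: "(1 + \<epsilon>) * card X \<le> card S"
    if "vertex_cut G S" "separated ?E (?V - S) X" "X \<noteq> {}" for S X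
    using toughness_le[OF \<open>graph G\<close> that] assms(8)
    by (meson mult_right_mono of_nat_0_le_iff order.trans)

  have kappa: "2 * m + 2 * n + 1 \<le> ?\<kappa>" and order: "?\<kappa> + 2 \<le> card ?V"
  proof -
    obtain S where S: "vertex_cut G S" "?\<kappa> = card S" and "?\<kappa> + 2 \<le> card ?V"
      using vertex_connectivity_attained[OF \<open>graph G\<close> assms(6)] by blast
    then show "?\<kappa> + 2 \<le> card ?V" by simp
    obtain u v where uv: "u \<in> ?V - S" "v \<in> ?V - S" "(u, v) \<notin> (joined ?E (?V - S))\<^sup>*"
      using S(1) vertex_cut_iff[OF \<open>graph G\<close>] by blast
    then have "u \<noteq> v" and "separated ?E (?V - S) {u, v}"
      by (auto simp: separated_def dest: joined_rtrancl_sym)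
    then have "2 * (1 + \<epsilon>) \<le> ?\<kappa>"
      using tough[OF S(1), of "{u, v}"] S(2) by simp
    define q where "q = real m + real n - 1"
    have "0 < q"
      using assms(1,2) by (simp add: q_def)
    have "2 * q * (1 + \<epsilon>) < ?\<kappa> * \<epsilon>"
      using assms(3,9) by (simp add: q_def pos_divide_less_eq algebra_simps)
    \<comment> \<open>Here \<open>2 * q + 2 = 2 * m + 2 * n\<close>. If \<open>?\<kappa>\<close>
      were at most this, the bound from the cut \<open>S\<close> would give \<epsilon> \<le> q,
      while the connectivity hypothesis would give q < \<epsilon>.\<close>
    have "real ?\<kappa> > 2 * q + 2"
    proof (rule ccontr)
      assume "\<not> real ?\<kappa> > 2 * q + 2"
      then have "?\<kappa> \<le> 2 * q + 2" by simp
      moreover from this have "\<epsilon> \<le> q"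
        using \<open>2 * (1 + \<epsilon>) \<le> ?\<kappa>\<close> by simp
      moreover have "?\<kappa> * \<epsilon> \<le> (2 * q + 2) * \<epsilon>"
        using calculation(1) assms(3) by (simp add: mult_right_mono)
      ultimately show False
        using \<open>2 * q * (1 + \<epsilon>) < ?\<kappa> * \<epsilon>\<close> by (simp add: algebra_simps)
    qed
    then show "2 * m + 2 * n + 1 \<le> ?\<kappa>"
      by (simp add: q_def)
  qed
  have robust: "(u, v) \<in> (joined ?E (?V - T))\<^sup>*"
    if "T \<subseteq> ?V" "card T \<le> 2 * m + 2 * n" "u \<in> ?V - T" "v \<in> ?V - T" for T u v
    using that kappa vertex_connectivity_le[OF \<open>graph G\<close>, of T] vertex_cut_iff[OF \<open>graph G\<close>, of T]
    by fastforce
  have minus_connected: "(u, v) \<in> (joined (?E - N) (?V - S))\<^sup>*"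
    if "matching G N" "card N \<le> n" "S \<subseteq> ?V" "card S \<le> 2 * m + n" "u \<in> ?V - S" "v \<in> ?V - S"
    for N S u v
  proof (rule connected_minus_matching[where k = "2 * m + 2 * n"])
    show "finite N"
      using that(1) by (rule fin_matching)
    show "finite S"
      using that(3) finite_verts by (rule finite_subset)
    \<comment> \<open>The order is at least \<open>2 * m + 2 * n + 3\<close>, and at most
      \<open>2 * m + n\<close> vertices are removed.\<close>
    then show "3 \<le> card (?V - S)"
      using that(3,4) order kappa assms(2) by (simp add: card_Diff_subset)
  qed (use that robust card_edge in \<open>auto simp: matching_iff\<close>)

  \<comment> \<open>Allowing fewer than \<open>m\<close> and \<open>n\<close> edges lets empty
    matchings yield the mere existence of perfect matchings in \<open>G\<close> and in
    \<open>G\<close> without \<open>N\<close>.\<close>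
  have extend: "\<exists>F. perfect_matching G F \<and> M \<subseteq> F \<and> N \<inter> F = {}"
    if M: "matching G M" "card M \<le> m" and N: "matching G N" "card N \<le> n" and "M \<inter> N = {}" for M N
  proof -
    have fin: "finite M" "finite N"
      using M N by (auto intro: fin_matching)
    have MV: "\<Union>M \<subseteq> ?V" "finite (\<Union>M)" "card (\<Union>M) = 2 * card M"
    proof -
      show "\<Union>M \<subseteq> ?V" using M by (simp add: matching_iff matching_in_def)
      then show "finite (\<Union>M)" using finite_verts by (rule finite_subset)
      show "card (\<Union>M) = 2 * card M"
        using M card_edge by (intro card_Union_pairs) (auto simp: matching_def)
    qed
    define W where "W = ?V - \<Union>M"
    have "finite W" by (simp add: W_def)
    have E_N: "\<And>e. e \<in> ?E - N \<Longrightarrow> card e = 2"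
      using card_edge by simp
    obtain U X K where U: "U \<subseteq> W" and X: "separated (?E - N) (W - U) X"
      and K: "matching_in (?E - N) W K" and card_X: "card W + card U \<le> card X + 2 * card K"
      using Tutte_Berge_separated[OF \<open>finite W\<close> E_N] by blast
    have KW: "\<Union>K \<subseteq> W" "card (\<Union>K) = 2 * card K"
    proof -
      show "\<Union>K \<subseteq> W" using K by (simp add: matching_in_def)
      show "card (\<Union>K) = 2 * card K"
        using K card_edge by (intro card_Union_pairs) (auto simp: matching_in_def)
    qed
    have "\<Union>K = W"
    proof (rule ccontr)
      assume "\<Union>K \<noteq> W"
      then have "2 * card K < card W"
        using KW \<open>finite W\<close> psubset_card_mono[of W "\<Union>K"] by auto
      \<comment> \<open>By parity \<open>K\<close> misses at least two vertices of \<open>W\<close>,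
        not just one; this is the surplus 2 of \<open>card X\<close> over
        \<open>card U\<close>.\<close>
      moreover have "even (card W)"
        using assms(7) MV by (simp add: W_def card_Diff_subset)
      ultimately have "2 * card K + 2 \<le> card W"
        by presburger
      then have "card U + 2 \<le> card X"
        using card_X by simp
      define S where "S = \<Union>M \<union> U"
      have WU: "W - U = ?V - S"
        by (auto simp: W_def S_def)
      have S: "S \<subseteq> ?V" "card S = 2 * card M + card U"
      proof -
        show "S \<subseteq> ?V" using MV U by (auto simp: S_def W_def)
        have "finite U" using U \<open>finite W\<close> by (rule finite_subset)
        then show "card S = 2 * card M + card U"
          using MV U unfolding S_def by (subst card_Un_disjoint) (auto simp: W_def)
      qed
      have "X \<subseteq> ?V - S"
        using X WU by (simp add: separated_def)
      then have "finite X"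
        by (rule finite_subset) simp
      have "\<not> card S \<le> 2 * m + n"
      proof
        assume "card S \<le> 2 * m + n"
        have "x = y" if "x \<in> X" "y \<in> X" for x y
          using X that minus_connected[OF N S(1) \<open>card S \<le> 2 * m + n\<close>, of x y] \<open>X \<subseteq> ?V - S\<close>
          by (auto simp: separated_def WU)
        then have "card X \<le> 1"
          using \<open>finite X\<close> by (simp add: card_le_Suc0_iff_eq)
        then show False
          using \<open>card U + 2 \<le> card X\<close> by simp
      qed
      moreover obtain Y where Y: "separated (N \<union> (?E - N)) (?V - S) Y" "card X \<le> card Y + card N"
        using separated_add_edges[OF fin(2) _ X \<open>finite X\<close>] N(1) card_edge WU
        by (auto simp: matching_def)
      \<comment> \<open>Since \<open>card S > 2 * m + n\<close> and \<open>card M \<le> m\<close>,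
        the set \<open>U\<close> has more than \<open>n\<close> vertices, so enough of
        \<open>X\<close> survives the loss of at most \<open>n\<close>.\<close>
      ultimately have "2 \<le> card Y"
        using S(2) M(2) N(2) \<open>card U + 2 \<le> card X\<close> by linarith
      have Y_sep: "separated ?E (?V - S) Y"
        using Y(1) N(1) by (simp add: matching_def Un_absorb1)
      obtain x y where "x \<in> Y" "y \<in> Y" "x \<noteq> y"
        using \<open>2 \<le> card Y\<close> card_le_Suc0_iff_eq[of Y] card_ge_0_finite[of Y] by auto
      then have "vertex_cut G S"
        using Y_sep S(1) unfolding vertex_cut_iff[OF \<open>graph G\<close>] by (fastforce simp: separated_def)
      have "(1 + \<epsilon>) * card Y \<le> card S"
        using tough[OF \<open>vertex_cut G S\<close> Y_sep] \<open>x \<in> Y\<close> by auto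
      \<comment> \<open>From \<open>card Y \<ge> card X - n \<ge> card U + 2 - n\<close> and
        \<open>card U \<ge> card S - 2 * m\<close>; the subtraction is in the reals, hence not
        truncated.\<close>
      moreover have "card S - (2 * real m + real n - 2) \<le> card Y"
        using S(2) M(2) N(2) Y(2) \<open>card U + 2 \<le> card X\<close> by linarith
      ultimately have "(card S - (2 * real m + real n - 2)) * (1 + \<epsilon>) \<le> card S"
        using assms(3) mult_right_mono[of "card S - (2 * real m + real n - 2)" "card Y" "1 + \<epsilon>"]
        by argo
      then have "card S \<le> (2 * real m + 2 * real n - 2) * (1 + \<epsilon>) / \<epsilon>"
        by (rule ratio_bound[OF assms(3)]) simp
      then show False
        using assms(9) vertex_connectivity_le[OF \<open>graph G\<close> \<open>vertex_cut G S\<close>] by simp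
    qed
    then have "pairwise disjnt (M \<union> K)"
    proof -
      have "disjnt e f" if "e \<in> M" "f \<in> K" for e f
        using that \<open>\<Union>K = W\<close> by (auto simp: W_def disjnt_iff)
      then show ?thesis
        using M(1) K unfolding matching_def matching_in_def pairwise_def
        by (metis UnE disjnt_sym)
    qed
    then have "perfect_matching G (M \<union> K)"
      using M K \<open>\<Union>K = W\<close> MV(1) by (auto simp: perfect_matching_def matching_def matching_in_def W_def)
    moreover have "N \<inter> (M \<union> K) = {}"
      using K \<open>M \<inter> N = {}\<close> by (auto simp: matching_in_def)
    ultimately show ?thesis by blast
  qed

  have "extendable m (del_edges G N)" if N: "matching G N" "card N = n" for N
    unfolding extendable_def
  proof (intro conjI allI impI)
    have sym: "sym_digraph (del_edges G N)"
      using \<open>graph G\<close> by (rule sym_digraph_del_edges)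
    have "?V \<noteq> {}"
      using order by auto
    then show "Digraph_Component.connected (del_edges G N)"
      using minus_connected[of N "{}"] N
      by (simp add: connected_iff_joined[OF sym] edges_del_edges verts_del_edges)
    have lift: "perfect_matching (del_edges G N) F" if "perfect_matching G F" "N \<inter> F = {}" for F
      using that by (auto simp: perfect_matching_def matching_def edges_del_edges verts_del_edges)
    show "\<exists>F. perfect_matching (del_edges G N) F"
      using extend[of "{}" N] N lift by (auto simp: matching_def)
    show "2 * m + 2 \<le> card (verts (del_edges G N))"
      using order kappa by (simp add: verts_del_edges)
    fix M assume "matching (del_edges G N) M \<and> card M = m"
    then have "matching G M" "card M \<le> m" "M \<inter> N = {}"
      by (auto simp: matching_def edges_del_edges)
    then show "\<exists>F. perfect_matching (del_edges G N) F \<and> M \<subseteq> F"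
      using extend[of M N] N lift by auto
  qed
  moreover have "\<exists>F. perfect_matching G F"
    using extend[of "{}" "{}"] by (auto simp: matching_def)
  ultimately show ?thesis
    using assms(5) order kappa by (simp add: E_extendable_def)
qed

end
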